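(* There exist decision trees whose Blake canonical form, for some class, has size exponential in the size of the tree. Precisely: there exist a real constant $a>1$ and a sequence $(\mathcal{T}_r)_{r\ge 1}$ of decision trees over Boolean features, with the number of nodes $|\mathcal{T}_r|\to\infty$, such that for every $r\ge 1$ there is a class $c$ for which the number of terms of $\mathsf{BCF}_c(\mathcal{T}_r)$ is at least $a^{|\mathcal{T}_r|}$.
   Context: Features are $\mathcal{F}=\{1,\dots,m\}$, each with Boolean domain $\{0,1\}$; feature space is $\mathbb{F}=\{0,1\}^m$; $\mathbb{K}$ is a finite set of classes. A decision tree (DT) $\mathcal{T}$ is a finite rooted tree in which each non-terminal node is labelled with a feature $i$ and has two children, one for the value $x_i=0$ and one for $x_i=1$, and each terminal node is labelled with a class in $\mathbb{K}$. The set of literals on every root-to-terminal path is consistent, and each $\mathbf{x}\in\mathbb{F}$ is consistent with exactly one root-to-terminal path. $\mathcal{T}$ computes the function $\kappa_{\mathcal{T}}:\mathbb{F}\to\mathbb{K}$ sending $\mathbf{x}$ to the class at the end of that path. The size $|\mathcal{T}|$ is the number of nodes. For a class $c$, let $\pi_c:\mathbb{F}\to\{\bot,\top\}$ be the predicate $\pi_c(\mathbf{x})=[\kappa_{\mathcal{T}}(\mathbf{x})=c]$. A term is a consistent conjunction of literals ($x_i$ or $\neg x_i$). An implicant of $\pi_c$ is a term $t$ such that $t(\mathbf{x})\to\pi_c(\mathbf{x})$ for all $\mathbf{x}\in\mathbb{F}$. A prime implicant is an implicant such that dropping any of its literals yields a term that is no longer an implicant. The Blake canonical form $\mathsf{BCF}_c(\mathcal{T})$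 is the disjunction of all prime implicants of $\pi_c$; its terms are these prime implicants. *)

theory Defs
  imports Complex_Main "HOL-Library.FuncSet"
begin

text \<open>The literal \<open>(i, v)\<close> stands for \<open>x\<^sub>i = v\<close>: \<open>(i, True)\<close> is the positive
  and \<open>(i, False)\<close> the negated literal of feature \<open>i\<close>.\<close>

type_synonym literal = "nat \<times> bool"

definition feature_space :: "nat \<Rightarrow> (nat \<Rightarrow> bool) set" where
  "feature_space m = {1..m} \<rightarrow>\<^sub>E UNIV"

definition consistent :: "literal set \<Rightarrow> bool" where
  "consistent L \<longleftrightarrow> (\<forall>i. \<not> ((i, True) \<in> L \<and> (i, False) \<in> L))"

definition satisfies :: "(nat \<Rightarrow> bool) \<Rightarrow> literal set \<Rightarrow> bool" where
  "satisfies x L \<longleftrightarrow> (\<forall>(i, v)\<in>L. x i = v)"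

text \<open>In \<open>Node i t0 t1\<close>, the subtree \<open>t0\<close> is the child for \<open>x\<^sub>i = 0\<close> and \<open>t1\<close> the one
  for \<open>x\<^sub>i = 1\<close>.\<close>

datatype 'k dtree = Leaf 'k | Node nat "'k dtree" "'k dtree"

text \<open>Unlike the generated \<open>size\<close> function, this also counts the terminal nodes.\<close>

fun num_nodes :: "'k dtree \<Rightarrow> nat" where
  "num_nodes (Leaf c) = 1"
| "num_nodes (Node i t0 t1) = 1 + num_nodes t0 + num_nodes t1"

fun features :: "'k dtree \<Rightarrow> nat set" where
  "features (Leaf c) = {}"
| "features (Node i t0 t1) = insert i (features t0 \<union> features t1)"

text \<open>Root-to-terminal paths: the literals in order, together with the class at the end.\<close>

fun paths :: "'k dtree \<Rightarrow> (literal list \<times> 'k) set" where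
  "paths (Leaf c) = {([], c)}"
| "paths (Node i t0 t1) =
     (\<lambda>(p, c). ((i, False) # p, c)) ` paths t0 \<union> (\<lambda>(p, c). ((i, True) # p, c)) ` paths t1"

definition decision_tree :: "nat \<Rightarrow> 'k set \<Rightarrow> 'k dtree \<Rightarrow> bool" where
  "decision_tree m K T \<longleftrightarrow>
     features T \<subseteq> {1..m} \<and> set_dtree T \<subseteq> K \<and> (\<forall>(p, c)\<in>paths T. consistent (set p))"

fun kappa :: "'k dtree \<Rightarrow> (nat \<Rightarrow> bool) \<Rightarrow> 'k" where
  "kappa (Leaf c) x = c"
| "kappa (Node i t0 t1) x = (if x i then kappa t1 x else kappa t0 x)"

text \<open>Each point is consistent with exactly one root-to-terminal path, and \<open>kappa\<close> is the
  class at the end of that path.\<close>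

lemma ex1_path: "\<exists>!q. q \<in> paths T \<and> satisfies x (set (fst q))"
proof (induction T)
  case (Leaf c)
  then show ?case by (auto simp: satisfies_def)
next
  case (Node i t0 t1)
  define t where "t = (if x i then t1 else t0)"
  have iff: "q \<in> paths (Node i t0 t1) \<and> satisfies x (set (fst q)) \<longleftrightarrow>
      (\<exists>q'. q' \<in> paths t \<and> satisfies x (set (fst q')) \<and> q = ((i, x i) # fst q', snd q'))" for q
    by (cases "x i") (auto simp: t_def satisfies_def image_iff split_beta Bex_def)
  have "\<exists>!q. q \<in> paths t \<and> satisfies x (set (fst q))"
    using Node.IH by (simp add: t_def)
  then show ?case unfolding iff by (elim ex1E, intro ex1I) blast+
qed

lemma kappa_path:
  assumes "(p, c) \<in> paths T" "satisfies x (set p)"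
  shows "kappa T x = c"
  using assms by (induction T arbitrary: p) (auto simp: satisfies_def)

definition class_pred :: "'k dtree \<Rightarrow> 'k \<Rightarrow> (nat \<Rightarrow> bool) \<Rightarrow> bool" where
  "class_pred T c x \<longleftrightarrow> kappa T x = c"

text \<open>A conjunction of literals is represented by its set of literals.\<close>

definition is_term :: "nat \<Rightarrow> literal set \<Rightarrow> bool" where
  "is_term m t \<longleftrightarrow> fst ` t \<subseteq> {1..m} \<and> consistent t"

definition implicant :: "nat \<Rightarrow> ((nat \<Rightarrow> bool) \<Rightarrow> bool) \<Rightarrow> literal set \<Rightarrow> bool" where
  "implicant m f t \<longleftrightarrow> is_term m t \<and> (\<forall>x\<in>feature_space m. satisfies x t \<longrightarrow> f x)"

definition prime_implicant :: "nat \<Rightarrow> ((nat \<Rightarrow> bool) \<Rightarrow> bool) \<Rightarrow> literal set \<Rightarrow> bool" where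
  "prime_implicant m f t \<longleftrightarrow> implicant m f t \<and> (\<forall>l\<in>t. \<not> implicant m f (t - {l}))"

text \<open>The Blake canonical form, a disjunction of terms, is represented by its set of terms.\<close>

definition BCF :: "nat \<Rightarrow> 'k dtree \<Rightarrow> 'k \<Rightarrow> literal set set" where
  "BCF m T c = {t. prime_implicant m (class_pred T c) t}"

lemma finite_BCF: "finite (BCF m T c)"
proof (rule finite_subset)
  show "BCF m T c \<subseteq> Pow ({1..m} \<times> UNIV)"
    by (fastforce simp: BCF_def prime_implicant_def implicant_def is_term_def)
  show "finite (Pow ({1..m} \<times> (UNIV :: bool set)))" by simp
qed

end

theory Submission imports Defs
begin

text \<open>The tree tests selectors \<open>s\<^sub>i\<close> one after the other; at the first selector that is on it
  outputs \<open>y\<^sub>i\<close>, and it outputs \<open>1\<close> if all selectors are off. For each of the \<open>n\<close> indices choose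
  one of the literals \<open>\<not> s\<^sub>i\<close> and \<open>y\<^sub>i\<close>: the term obtained forces output \<open>1\<close>, and once the literal
  of index \<open>i\<close> is dropped, it is satisfied by a point with \<open>s\<^sub>i = 1\<close>, \<open>y\<^sub>i = 0\<close> and all other selectors
  off, where the output is \<open>0\<close>. So a tree with \<open>4 n + 1\<close> nodes has at least \<open>2\<^sup>n\<close> prime implicants.\<close>

text \<open>The features are \<open>s\<^sub>i = 2 i + 1\<close> and \<open>y\<^sub>i = 2 i + 2\<close> for \<open>i < n\<close>, tested by decreasing \<open>i\<close>.\<close>

fun selector_tree :: "nat \<Rightarrow> nat dtree" where
  "selector_tree 0 = Leaf 1"
| "selector_tree (Suc n) =
     Node (2 * n + 1) (selector_tree n) (Node (2 * n + 2) (Leaf 0) (Leaf 1))"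

text \<open>A choice is coded by the set of indices at which the negated selector is picked, so
  counting choices becomes counting subsets of \<open>{..<n}\<close>.\<close>

definition choice_literal :: "nat set \<Rightarrow> nat \<Rightarrow> literal" where
  "choice_literal A i = (if i \<in> A then (2 * i + 1, False) else (2 * i + 2, True))"

definition choice_term :: "nat \<Rightarrow> nat set \<Rightarrow> literal set" where
  "choice_term n A = choice_literal A ` {..<n}"

lemma num_nodes_selector_tree: "num_nodes (selector_tree n) = 4 * n + 1"
  by (induction n) auto

lemma set_selector_tree: "set_dtree (selector_tree n) \<subseteq> {0, 1}"
  by (induction n) auto

lemma features_selector_tree: "features (selector_tree n) \<subseteq> {1..2 * n}"
  by (induction n) auto

lemma paths_features: "(p, c) \<in> paths T \<Longrightarrow> fst ` set p \<subseteq> features T"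
  by (induction T arbitrary: p) fastforce+

lemma consistent_insert:
  assumes "consistent L" "i \<notin> fst ` L"
  shows "consistent (insert (i, v) L)"
proof -
  have "(i, b) \<notin> L" for b
    using assms(2) by (metis fst_conv imageI)
  with assms(1) show ?thesis by (auto simp: consistent_def)
qed

text \<open>No path repeats a feature: the root selector \<open>2 * n + 1\<close> exceeds every
  feature of the subtree for \<open>n\<close>, and the other branch tests only one further,
  different feature.\<close>

lemma consistent_paths_selector_tree:
  "(p, c) \<in> paths (selector_tree n) \<Longrightarrow> consistent (set p)"
proof (induction n arbitrary: p)
  case 0
  then show ?case by (simp add: consistent_def)
next
  case (Suc n)
  have "consistent (set ((2 * n + 1, False) # q))" if "(q, c) \<in> paths (selector_tree n)" for q
  proof -
    have "fst ` set q \<subseteq> {1..2 * n}"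
      using paths_features[OF that] features_selector_tree by (rule subset_trans)
    then have "2 * n + 1 \<notin> fst ` set q" by (rule contra_subsetD) simp
    with Suc.IH[OF that] show ?thesis by (simp add: consistent_insert)
  qed
  with Suc.prems show ?case by (auto simp: consistent_def)
qed

lemma decision_tree_selector_tree: "decision_tree (2 * n) {0, 1} (selector_tree n)"
  using features_selector_tree set_selector_tree consistent_paths_selector_tree
  unfolding decision_tree_def by blast

lemma kappa_selector_tree_one:
  assumes "\<And>i. i < n \<Longrightarrow> x (2 * i + 1) \<Longrightarrow> x (2 * i + 2)"
  shows "kappa (selector_tree n) x = 1"
  using assms by (induction n) auto

lemma kappa_selector_tree_zero:
  assumes "i < n" "x (2 * i + 1)" "\<not> x (2 * i + 2)"
    and "\<And>j. j < n \<Longrightarrow> j \<noteq> i \<Longrightarrow> \<not> x (2 * j + 1)"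
  shows "kappa (selector_tree n) x = 0"
  using assms by (induction n) (auto simp: less_Suc_eq)

text \<open>Selectors are odd and values even, so a literal reveals both its index and the choice
  made there.\<close>

lemma choice_literal_eq_iff: "choice_literal A i = choice_literal B j \<longleftrightarrow> i = j \<and> (i \<in> A \<longleftrightarrow> j \<in> B)"
proof -
  have "2 * i + 1 \<noteq> 2 * j + 2" "2 * j + 1 \<noteq> 2 * i + 2" by presburger+
  then show ?thesis by (auto simp: choice_literal_def)
qed

lemma inj_on_choice_term: "inj_on (choice_term n) (Pow {..<n})"
proof (rule inj_onI)
  fix A B assume AB: "A \<in> Pow {..<n}" "B \<in> Pow {..<n}" and eq: "choice_term n A = choice_term n B"
  have "i \<in> A \<longleftrightarrow> i \<in> B" if "i < n" for i
  proof -
    have "choice_literal A i \<in> choice_term n B"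
      using that unfolding eq[symmetric] by (simp add: choice_term_def)
    then show ?thesis by (auto simp: choice_term_def choice_literal_eq_iff)
  qed
  with AB show "A = B" by blast
qed

lemma implicant_choice_term:
  "implicant (2 * n) (class_pred (selector_tree n) 1) (choice_term n A)"
proof -
  have "is_term (2 * n) (choice_term n A)"
  proof -
    \<comment> \<open>Consistency by parity: positive literals occur only at values and negative
      ones only at selectors.\<close>
    have "even j" if "(j, True) \<in> choice_term n A" for j
      using that by (auto simp: choice_term_def choice_literal_def split: if_splits)
    moreover have "odd j" if "(j, False) \<in> choice_term n A" for j
      using that by (auto simp: choice_term_def choice_literal_def split: if_splits)
    ultimately show ?thesis
      by (auto simp: is_term_def consistent_def choice_term_def choice_literal_def)
  qed
  moreover have "kappa (selector_tree n) x = 1" if "satisfies x (choice_term n A)" for x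
  proof (rule kappa_selector_tree_one)
    fix i assume "i < n" "x (2 * i + 1)"
    moreover have "x (fst (choice_literal A i)) = snd (choice_literal A i)"
      using that \<open>i < n\<close> by (auto simp: satisfies_def choice_term_def split_beta)
    ultimately show "x (2 * i + 2)" by (auto simp: choice_literal_def split: if_splits)
  qed
  ultimately show ?thesis by (simp add: implicant_def class_pred_def)
qed

lemma not_implicant_choice_term_remove:
  assumes "i < n"
  shows "\<not> implicant (2 * n) (class_pred (selector_tree n) 1)
           (choice_term n A - {choice_literal A i})"
proof -
  \<comment> \<open>All values other than \<open>y\<^sub>i\<close> are on, so this one point
    satisfies both possible literals of every index \<open>j \<noteq> i\<close> and works for every
    \<open>A\<close>. The restriction puts it into the extensional function space
    \<open>feature_space\<close>.\<close>
  define x where "x = restrict (\<lambda>k. k = 2 * i + 1 \<or> even k \<and> k \<noteq> 2 * i + 2) {1..2 * n}"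
  have x_sel: "x (2 * j + 1) \<longleftrightarrow> j = i" and x_val: "x (2 * j + 2) \<longleftrightarrow> j \<noteq> i" if "j < n" for j
    using that unfolding x_def by auto
  have "x \<in> feature_space (2 * n)" by (auto simp: x_def feature_space_def)
  moreover have "satisfies x (choice_term n A - {choice_literal A i})"
  proof -
    have "x (fst (choice_literal A j)) = snd (choice_literal A j)" if "j < n" "j \<noteq> i" for j
      using that x_sel[of j] x_val[of j] by (simp add: choice_literal_def)
    moreover have "j \<noteq> i" if "choice_literal A j \<noteq> choice_literal A i" for j
      using that by blast
    ultimately show ?thesis by (auto simp: satisfies_def choice_term_def split_beta)
  qed
  moreover have "kappa (selector_tree n) x = 0"
    using assms x_sel x_val by (intro kappa_selector_tree_zero[of i]) auto
  ultimately show ?thesis by (auto simp: implicant_def class_pred_def)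
qed

lemma choice_term_in_BCF: "choice_term n A \<in> BCF (2 * n) (selector_tree n) 1"
  using implicant_choice_term not_implicant_choice_term_remove
  by (auto simp: BCF_def prime_implicant_def choice_term_def)

lemma card_BCF_selector_tree: "2 ^ n \<le> card (BCF (2 * n) (selector_tree n) 1)"
proof -
  have "2 ^ n = card (choice_term n ` Pow {..<n})"
    by (simp add: card_image inj_on_choice_term card_Pow)
  also have "\<dots> \<le> card (BCF (2 * n) (selector_tree n) 1)"
    using choice_term_in_BCF by (intro card_mono finite_BCF) auto
  finally show ?thesis .
qed

theorem theorem1:
  "\<exists>(a::real) (K::nat set) (m::nat \<Rightarrow> nat) (T::nat \<Rightarrow> nat dtree).
     a > 1 \<and> finite K \<and>
     (\<forall>r\<ge>1. decision_tree (m r) K (T r)) \<and>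
     filterlim (\<lambda>r. num_nodes (T r)) at_top sequentially \<and>
     (\<forall>r\<ge>1. \<exists>c\<in>K. real (card (BCF (m r) (T r) c)) \<ge> a ^ num_nodes (T r))"
proof (intro exI conjI)
  \<comment> \<open>The fifth root suffices because \<open>4 * r + 1 \<le> 5 * r\<close> for
    \<open>r \<ge> 1\<close>.\<close>
  define a where "a = root 5 (2::real)"
  have a5: "a ^ 5 = 2" by (simp add: a_def)
  show a1: "root 5 (2::real) > 1" by simp
  show "finite {0::nat, 1}" by simp
  show "\<forall>r\<ge>1. decision_tree (2 * r) {0, 1} (selector_tree r)"
    using decision_tree_selector_tree by blast
  show "filterlim (\<lambda>r. num_nodes (selector_tree r)) at_top sequentially"
    by (rule filterlim_at_top_mono[OF filterlim_ident])
      (auto simp: num_nodes_selector_tree)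
  have "a ^ num_nodes (selector_tree r) \<le> real (card (BCF (2 * r) (selector_tree r) 1))"
    if "r \<ge> 1" for r
  proof -
    have "a ^ num_nodes (selector_tree r) \<le> a ^ (5 * r)"
      using a1 that by (intro power_increasing) (auto simp: a_def num_nodes_selector_tree)
    also have "\<dots> = 2 ^ r" by (simp add: power_mult a5)
    also have "\<dots> \<le> real (card (BCF (2 * r) (selector_tree r) 1))"
      using card_BCF_selector_tree[of r] by (metis of_nat_le_iff of_nat_numeral of_nat_power)
    finally show ?thesis .
  qed
  then show "\<forall>r\<ge>1. \<exists>c\<in>{0, 1}. real (card (BCF (2 * r) (selector_tree r) c))
      \<ge> root 5 2 ^ num_nodes (selector_tree r)"
    by (auto simp: a_def)
qed

end
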